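(* Let $M=\begin{pmatrix}1&1\\0&1\end{pmatrix}$, $v_1=(0,1)^T$ and $v_2=(0,-1)^T$. Let $L_0$ be the language, over the two-letter alphabet $\{v_1,v_2\}$, of all nonempty finite strings $v$ with $[v]_M=(0,0)^T$. Then $L_0$ is not a context-free language.
   Context: For a string $a_ka_{k-1}\cdots a_0$ of letters $a_i\in\{v_1,v_2\}$, its value in base $M$ is $[a_ka_{k-1}\cdots a_0]_M=M^ka_k+\dots+M a_1+a_0\in\mathbb{Z}^2$. *)

theory Defs
  imports "HOL-Analysis.Analysis"
begin

section \<open>Context-free languages\<close>

datatype ('n, 't) sym = NT 'n | Tm 't

type_synonym ('n, 't) prods = "('n \<times> ('n, 't) sym list) set"

inductive step :: "('n, 't) prods \<Rightarrow> ('n, 't) sym list \<Rightarrow> ('n, 't) sym list \<Rightarrow> bool"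
  for P :: "('n, 't) prods" where
  "(A, \<gamma>) \<in> P \<Longrightarrow> step P (u @ [NT A] @ v) (u @ \<gamma> @ v)"

definition generated :: "('n, 't) prods \<Rightarrow> 'n \<Rightarrow> 't list set" where
  "generated P S = {w. (step P)\<^sup>*\<^sup>* [NT S] (map Tm w)}"

text \<open>A finite set of productions mentions only finitely many nonterminals, so taking them to be
  natural numbers is no restriction; the lemma \<open>context_freeI\<close> below proves this.\<close>

definition context_free :: "'t list set \<Rightarrow> bool" where
  "context_free L \<longleftrightarrow> (\<exists>(P :: (nat, 't) prods) S. finite P \<and> L = generated P S)"

primrec nts :: "('n, 't) sym \<Rightarrow> 'n set" where
  "nts (NT A) = {A}"
| "nts (Tm a) = {}"

abbreviation rename :: "('n \<Rightarrow> 'm) \<Rightarrow> ('n, 't) sym list \<Rightarrow> ('m, 't) sym list" where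
  "rename f \<equiv> map (map_sym f id)"

lemma step_rename:
  assumes "step P x y"
  shows "step ((\<lambda>(A, \<gamma>). (f A, rename f \<gamma>)) ` P) (rename f x) (rename f y)"
  using assms
proof cases
  case (1 A \<gamma> u v)
  then have "(f A, rename f \<gamma>) \<in> (\<lambda>(A, \<gamma>). (f A, rename f \<gamma>)) ` P" by force
  from step.intros[OF this, of "rename f u" "rename f v"] 1 show ?thesis by simp
qed

lemma steps_rename:
  assumes "(step P)\<^sup>*\<^sup>* x y"
  shows "(step ((\<lambda>(A, \<gamma>). (f A, rename f \<gamma>)) ` P))\<^sup>*\<^sup>* (rename f x) (rename f y)"
  using assms
proof induction
  case (step y z)
  then show ?case using step_rename[of P y z f] by (meson rtranclp.rtrancl_into_rtrancl)
qed simp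

lemma rename_Tm [simp]: "rename f (map Tm w) = map Tm w"
  by (induction w) auto

lemma rename_inverse:
  assumes "\<And>A. A \<in> \<Union> (nts ` set x) \<Longrightarrow> g (f A) = A"
  shows "rename g (rename f x) = x"
  using assms
proof (induction x)
  case (Cons s x)
  then show ?case by (cases s) auto
qed simp

lemma context_freeI:
  fixes P :: "('n, 't) prods"
  assumes "finite P"
  shows "context_free (generated P S)"
proof -
  define N where "N = insert S (fst ` P \<union> (\<Union>(A, \<gamma>)\<in>P. \<Union> (nts ` set \<gamma>)))"
  have "finite (nts s)" for s :: "('n, 't) sym" by (cases s) auto
  then have "finite N" using assms by (auto simp: N_def)
  then obtain f :: "'n \<Rightarrow> nat" where f: "inj_on f N"
    using finite_imp_inj_to_nat_seg by blast
  define g where "g = inv_into N f"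
  have gf: "g (f A) = A" if "A \<in> N" for A using f that by (simp add: g_def)
  define Q where "Q = (\<lambda>(A, \<gamma>). (f A, rename f \<gamma>)) ` P"
  have inv: "(case (A, \<gamma>) of (A, \<gamma>) \<Rightarrow> (g (f A), rename g (rename f \<gamma>))) = (A, \<gamma>)"
    if "(A, \<gamma>) \<in> P" for A \<gamma>
  proof -
    have "A \<in> N" using that by (force simp: N_def)
    moreover have "\<Union> (nts ` set \<gamma>) \<subseteq> N" using that by (force simp: N_def)
    ultimately show ?thesis using gf rename_inverse[of \<gamma> g f] by (simp add: subset_iff)
  qed
  have QP: "(\<lambda>(A, \<gamma>). (g A, rename g \<gamma>)) ` Q = P"
    unfolding Q_def image_image using inv by (force simp del: map_map simp: image_iff)
  have gS: "g (f S) = S" using gf by (simp add: N_def)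
  have "generated P S = generated Q (f S)"
  proof (intro set_eqI iffI)
    fix w assume "w \<in> generated P S"
    then show "w \<in> generated Q (f S)"
      using steps_rename[of P "[NT S]" "map Tm w" f] unfolding rename_Tm
      by (simp add: generated_def Q_def)
  next
    fix w assume "w \<in> generated Q (f S)"
    then show "w \<in> generated P S"
      using steps_rename[of Q "[NT (f S)]" "map Tm w" g] unfolding rename_Tm QP
      by (simp add: generated_def gS)
  qed
  moreover have "finite Q" using assms by (simp add: Q_def)
  ultimately show ?thesis unfolding context_free_def by blast
qed

section \<open>Values of strings in a matrix base\<close>

primrec matrix_pow :: "int ^ 'n ^ 'n \<Rightarrow> nat \<Rightarrow> int ^ 'n ^ 'n" where
  "matrix_pow M 0 = mat 1"
| "matrix_pow M (Suc k) = M ** matrix_pow M k"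

text \<open>The string \<open>a\<^sub>k \<dots> a\<^sub>0\<close> is the list \<open>[a\<^sub>k, \<dots>, a\<^sub>0]\<close> with the leading digit first, so
  \<open>a\<^sub>i\<close> is entry \<open>i\<close> of the reversed list.\<close>

definition base_value :: "int ^ 'n ^ 'n \<Rightarrow> (int ^ 'n) list \<Rightarrow> int ^ 'n" where
  "base_value M w = (\<Sum>i<length w. matrix_pow M i *v (rev w ! i))"

end

theory Submission
  imports Defs "HOL-Library.Sublist"
begin

text \<open>Since \<open>M\<^sup>i (0, s) = (i s, s)\<close>, a word over \<open>{v\<^sub>1, v\<^sub>2}\<close> has value 0 iff it has as many \<open>v\<^sub>1\<close>
  as \<open>v\<^sub>2\<close> and the positions of both letters have the same sum. Hence the word
  \<open>v\<^sub>1\<^sup>i v\<^sub>2\<^sup>j v\<^sub>1\<^sup>k\<close> has value 0 only if \<open>i = k\<close> and \<open>j = 2 i\<close>.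
  In a context-free language one can delete two pieces, not both empty, that lie within a factor of
  bounded length, from every long word. In \<open>v\<^sub>1\<^sup>n v\<^sub>2\<^sup>n v\<^sub>2\<^sup>n v\<^sub>1\<^sup>n\<close> with \<open>n\<close> large
  this factor misses one of the outer blocks, and after the deletion the word still has the form
  \<open>v\<^sub>1\<^sup>i v\<^sub>2\<^sup>j v\<^sub>1\<^sup>k\<close> with \<open>i = n\<close> or \<open>k = n\<close>, so that nothing can have been deleted.\<close>

section \<open>Parse trees\<close>

datatype ('n, 't) ptree = Lf 't | Nd 'n "('n, 't) ptree list"

primrec root_sym :: "('n, 't) ptree \<Rightarrow> ('n, 't) sym" where
  "root_sym (Lf a) = Tm a"
| "root_sym (Nd A ts) = NT A"

primrec yield :: "('n, 't) ptree \<Rightarrow> 't list" where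
  "yield (Lf a) = [a]"
| "yield (Nd A ts) = concat (map yield ts)"

primrec labels :: "('n, 't) ptree \<Rightarrow> 'n set" where
  "labels (Lf a) = {}"
| "labels (Nd A ts) = insert A (\<Union> (set (map labels ts)))"

primrec valid :: "('n, 't) prods \<Rightarrow> ('n, 't) ptree \<Rightarrow> bool" where
  "valid P (Lf a) = True"
| "valid P (Nd A ts) = ((A, map root_sym ts) \<in> P \<and> list_all (\<lambda>b. b) (map (valid P) ts))"

text \<open>Repetition is meant along a path from the root; different branches may share
  labels.\<close>

primrec repetition_free :: "('n, 't) ptree \<Rightarrow> bool" where
  "repetition_free (Lf a) = True"
| "repetition_free (Nd A ts) =
    (A \<notin> \<Union> (set (map labels ts)) \<and> list_all (\<lambda>b. b) (map repetition_free ts))"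

text \<open>Primitive recursion through the list of children leads to the \<open>map\<close> form;
  simplification uses quantifiers over the children from here on.\<close>

lemma valid_Nd [simp]: "valid P (Nd A ts) \<longleftrightarrow> (A, map root_sym ts) \<in> P \<and> (\<forall>t\<in>set ts. valid P t)"
  by (simp add: list_all_iff)

lemma repetition_free_Nd [simp]:
  "repetition_free (Nd A ts) \<longleftrightarrow>
    A \<notin> (\<Union>t\<in>set ts. labels t) \<and> (\<forall>t\<in>set ts. repetition_free t)"
  by (simp add: list_all_iff)

declare valid.simps(2) [simp del] repetition_free.simps(2) [simp del]

lemma finite_labels: "finite (labels t)"
  by (induction t) auto

lemma labels_valid: "valid P t \<Longrightarrow> labels t \<subseteq> fst ` P"
proof (induction t)
  case (Nd A ts)
  then have "A \<in> fst ` P" by (auto intro: image_eqI[of _ _ "(A, map root_sym ts)"])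
  moreover have "labels c \<subseteq> fst ` P" if "c \<in> set ts" for c using Nd that by simp
  ultimately show ?case by auto
qed simp

lemma length_concat_le:
  assumes "\<And>x. x \<in> set xs \<Longrightarrow> length (f x) \<le> k"
  shows "length (concat (map f xs)) \<le> length xs * k"
  using assms by (induction xs) (auto simp: add_mono)

text \<open>Below the root its label is no longer available, so each factor \<open>b\<close> for the
  branching is paid for by one label.\<close>

lemma length_yield_repetition_free:
  assumes "valid P t" "repetition_free t"
    and "\<And>A \<gamma>. (A, \<gamma>) \<in> P \<Longrightarrow> length \<gamma> \<le> b" and "b > 0"
  shows "length (yield t) \<le> b ^ card (labels t)"
  using assms(1,2)
proof (induction t)
  case (Lf a)
  then show ?case by simp
next
  case (Nd A ts)
  let ?N = "\<Union>t\<in>set ts. labels t"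
  have N: "finite ?N" by (simp add: finite_labels)
  have "length (yield t) \<le> b ^ card ?N" if "t \<in> set ts" for t
  proof -
    have "length (yield t) \<le> b ^ card (labels t)" using Nd that by simp
    also have "\<dots> \<le> b ^ card ?N"
      using that N \<open>b > 0\<close> by (intro power_increasing card_mono) auto
    finally show ?thesis .
  qed
  then have "length (yield (Nd A ts)) \<le> length ts * b ^ card ?N"
    unfolding yield.simps by (rule length_concat_le)
  also have "\<dots> \<le> b * b ^ card ?N"
    using assms(3)[of A "map root_sym ts"] Nd.prems(1) by simp
  also have "\<dots> = b ^ card (labels (Nd A ts))" using N Nd.prems(2) by simp
  finally show ?case .
qed

section \<open>Derivations and parse trees\<close>

lemma step_context: "step P x y \<Longrightarrow> step P (u @ x @ v) (u @ y @ v)"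
proof (induction rule: step.induct)
  case (1 A \<gamma> u' v')
  from step.intros[OF this, of "u @ u'" "v' @ v"] show ?case by simp
qed

lemma steps_context: "(step P)\<^sup>*\<^sup>* x y \<Longrightarrow> (step P)\<^sup>*\<^sup>* (u @ x @ v) (u @ y @ v)"
  by (induction rule: rtranclp_induct) (auto intro: step_context rtranclp.rtrancl_into_rtrancl)

lemma steps_concat:
  assumes "\<And>x. x \<in> set xs \<Longrightarrow> (step P)\<^sup>*\<^sup>* [f x] (g x)"
  shows "(step P)\<^sup>*\<^sup>* (map f xs) (concat (map g xs))"
  using assms
proof (induction xs)
  case (Cons x xs)
  have "(step P)\<^sup>*\<^sup>* ([] @ [f x] @ map f xs) ([] @ g x @ map f xs)"
    by (rule steps_context) (simp add: Cons.prems)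
  moreover have "(step P)\<^sup>*\<^sup>* (g x @ map f xs @ []) (g x @ concat (map g xs) @ [])"
    by (rule steps_context) (simp add: Cons)
  ultimately show ?case by simp
qed simp

lemma valid_imp_steps: "valid P t \<Longrightarrow> (step P)\<^sup>*\<^sup>* [root_sym t] (map Tm (yield t))"
proof (induction t)
  case (Lf a)
  then show ?case by simp
next
  case (Nd A ts)
  have "step P [NT A] (map root_sym ts)"
    using step.intros[of A "map root_sym ts" P "[]" "[]"] Nd.prems by simp
  moreover have "(step P)\<^sup>*\<^sup>* (map root_sym ts) (concat (map (map Tm \<circ> yield) ts))"
    by (rule steps_concat) (use Nd in simp)
  ultimately show ?case by (simp add: map_concat)
qed

text \<open>A sentential form corresponds to a forest, which allows induction from the first step:
  the trees over \<open>\<gamma>\<close> become the children of a new node \<open>A\<close>.\<close>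

lemma steps_imp_valid:
  assumes "(step P)\<^sup>*\<^sup>* \<alpha> (map Tm w)"
  shows "\<exists>ts. map root_sym ts = \<alpha> \<and> concat (map yield ts) = w \<and> (\<forall>t\<in>set ts. valid P t)"
  using assms
proof (induction rule: converse_rtranclp_induct)
  case base
  show ?case by (rule exI[of _ "map Lf w"]) (auto simp: comp_def)
next
  case (step \<alpha> \<beta>)
  from step(3) obtain ts where ts: "map root_sym ts = \<beta>" "concat (map yield ts) = w"
    "\<forall>t\<in>set ts. valid P t" by blast
  from step(1) obtain A \<gamma> u v where A: "(A, \<gamma>) \<in> P" "\<alpha> = u @ [NT A] @ v" "\<beta> = u @ \<gamma> @ v"
    by (auto elim: step.cases)
  have "map root_sym ts = u @ \<gamma> @ v" using ts(1) A(3) by simp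
  then obtain ts1 ts' where ts': "ts = ts1 @ ts'" "u = map root_sym ts1"
    "\<gamma> @ v = map root_sym ts'" unfolding map_eq_append_conv by (elim exE conjE) (rule that)
  from ts'(3) obtain ts2 ts3 where "ts' = ts2 @ ts3"
    "\<gamma> = map root_sym ts2" "v = map root_sym ts3"
    unfolding append_eq_map_conv by (elim exE conjE) (rule that)
  with ts ts'(1,2) A(1) show ?case
    unfolding A(2) by (intro exI[of _ "ts1 @ [Nd A ts2] @ ts3"]) (simp add: ball_Un)
qed

lemma generated_iff_ptree:
  "w \<in> generated P S \<longleftrightarrow> (\<exists>t. valid P t \<and> root_sym t = NT S \<and> yield t = w)"
proof
  assume "w \<in> generated P S"
  then have "(step P)\<^sup>*\<^sup>* [NT S] (map Tm w)" by (simp add: generated_def)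
  from steps_imp_valid[OF this] show "\<exists>t. valid P t \<and> root_sym t = NT S \<and> yield t = w" by auto
qed (auto simp: generated_def dest: valid_imp_steps)

section \<open>Deletion in context-free languages\<close>

text \<open>\<open>s\<close> is a subtree of \<open>t\<close> with yield \<open>u\<close> to its left and \<open>y\<close> to its right: it is
  described by what happens when another tree is grafted in its place.\<close>

definition occurs ::
    "('n, 't) prods \<Rightarrow> ('n, 't) ptree \<Rightarrow> ('n, 't) ptree \<Rightarrow> 't list \<Rightarrow> 't list \<Rightarrow> bool" where
  "occurs P t s u y \<longleftrightarrow> valid P s \<and> size s \<le> size t \<and> yield t = u @ yield s @ y \<and>
    (\<forall>s'. valid P s' \<and> root_sym s' = root_sym s \<longrightarrow>
      (\<exists>t'. valid P t' \<and> root_sym t' = root_sym t \<and> yield t' = u @ yield s' @ y \<and>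
        (size s' < size s \<longrightarrow> size t' < size t)))"

lemma occurs_refl: "valid P t \<Longrightarrow> occurs P t t [] []"
  by (auto simp: occurs_def)

text \<open>The context grows by the yields of the siblings of \<open>c\<close>; these stay
  unchanged, so the size comparison carries over.\<close>

lemma occurs_child:
  assumes "valid P (Nd A ts)" "c \<in> set ts" "occurs P c s u y"
  shows "\<exists>u' y'. occurs P (Nd A ts) s u' y'"
proof -
  obtain ts1 ts2 where ts: "ts = ts1 @ c # ts2" using assms(2) by (meson split_list)
  have "\<exists>t'. valid P t' \<and> root_sym t' = NT A \<and>
      yield t' = concat (map yield ts1) @ u @ yield s' @ y @ concat (map yield ts2) \<and>
      (size s' < size s \<longrightarrow> size t' < size (Nd A ts))" if "valid P s'" "root_sym s' = root_sym s" for s'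
  proof -
    from assms(3) that obtain c' where "valid P c'" "root_sym c' = root_sym c" "yield c' = u @ yield s' @ y"
      "size s' < size s \<longrightarrow> size c' < size c" unfolding occurs_def by blast
    then show ?thesis
      using assms(1) by (intro exI[of _ "Nd A (ts1 @ c' # ts2)"]) (auto simp: ts)
  qed
  then have "occurs P (Nd A ts) s (concat (map yield ts1) @ u) (y @ concat (map yield ts2))"
    using assms(3) by (simp add: occurs_def ts)
  then show ?thesis by blast
qed

lemma occurs_label:
  assumes "valid P t" "B \<in> labels t"
  shows "\<exists>s u y. root_sym s = NT B \<and> occurs P t s u y"
  using assms
proof (induction t)
  case (Nd A ts)
  show ?case
  proof (cases "B = A")
    case True
    then show ?thesis using occurs_refl[OF Nd.prems(1)] by (metis root_sym.simps(2))
  next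
    case False
    then obtain c where "c \<in> set ts" "B \<in> labels c" using Nd.prems by auto
    then show ?thesis using Nd occurs_child[OF Nd.prems(1)] by (metis valid_Nd)
  qed
qed simp

text \<open>Descend into a child with a repetition as long as there is one; where this stops, only
  the label of the node itself can recur.\<close>

lemma occurs_repetition:
  assumes "valid P t" "\<not> repetition_free t"
  shows "\<exists>A ts u y. occurs P t (Nd A ts) u y \<and> (\<forall>c\<in>set ts. repetition_free c) \<and>
    A \<in> (\<Union>c\<in>set ts. labels c)"
  using assms
proof (induction t)
  case (Nd A ts)
  show ?case
  proof (cases "\<forall>c\<in>set ts. repetition_free c")
    case True
    then show ?thesis using occurs_refl[OF Nd.prems(1)] Nd.prems(2) by (metis repetition_free_Nd)
  next
    case False
    then obtain c where "c \<in> set ts" "\<not> repetition_free c" by blast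
    then show ?thesis using Nd occurs_child[OF Nd.prems(1)] by (metis valid_Nd)
  qed
qed simp

text \<open>In a parse tree of least size for \<open>z\<close>, take a lowest subtree whose label occurs again below its
  root, and graft the lower occurrence in place of the upper one. Minimality gives \<open>v @ x \<noteq> []\<close>;
  the children of the subtree have no repetition on any path, which bounds its yield.\<close>

lemma context_free_pump_down:
  assumes "context_free L"
  shows "\<exists>n. \<forall>z\<in>L. length z > n \<longrightarrow>
    (\<exists>u v w x y. z = u @ v @ w @ x @ y \<and> v @ x \<noteq> [] \<and> length (v @ w @ x) \<le> n \<and> u @ w @ y \<in> L)"
proof -
  obtain P :: "(nat, 'a) prods" and S where P: "finite P" and L: "L = generated P S"
    using assms unfolding context_free_def by blast
  \<comment> \<open>The sum bounds every right-hand side; \<open>Suc\<close> makes \<open>b\<close>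
    positive even if it is 0, as monotonicity of powers requires.\<close>
  define b where "b = Suc (\<Sum>(A, \<gamma>)\<in>P. length \<gamma>)"
  have b: "length \<gamma> \<le> b" if "(A, \<gamma>) \<in> P" for A \<gamma>
    using member_le_sum[of "(A, \<gamma>)" P "\<lambda>(A, \<gamma>). length \<gamma>"] that P by (simp add: b_def)
  have b0: "b > 0" by (simp add: b_def)
  define m where "m = b ^ card (fst ` P)"
  have short: "length (yield t) \<le> m" if "valid P t" "repetition_free t" for t
  proof -
    have "length (yield t) \<le> b ^ card (labels t)"
      using length_yield_repetition_free[OF that b b0] .
    also have "\<dots> \<le> m"
      unfolding m_def using b0 P labels_valid[OF that(1)] by (intro power_increasing card_mono) auto
    finally show ?thesis .
  qed
  have "\<exists>u v w x y. z = u @ v @ w @ x @ y \<and> v @ x \<noteq> [] \<and> length (v @ w @ x) \<le> b * m \<and>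
      u @ w @ y \<in> L" if z: "z \<in> L" "length z > b * m" for z
  proof -
    let ?tree = "\<lambda>t. valid P t \<and> root_sym t = NT S \<and> yield t = z"
    obtain t where t: "?tree t" and least: "\<And>t'. ?tree t' \<Longrightarrow> size t \<le> size t'"
      using z(1) ex_has_least_nat[of ?tree _ size] unfolding L generated_iff_ptree by metis
    have "m \<le> b * m" using b0 by simp
    then have "\<not> repetition_free t" using short[of t] t z(2) by (metis le_trans not_less)
    then obtain A ts u y where occ: "occurs P t (Nd A ts) u y"
      and free: "\<forall>c\<in>set ts. repetition_free c" and A: "A \<in> (\<Union>c\<in>set ts. labels c)"
      using occurs_repetition[of P t] t by blast
    have val: "valid P (Nd A ts)" using occ by (simp add: occurs_def)
    obtain c where c: "c \<in> set ts" "A \<in> labels c" using A by blast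
    obtain s u' y' where s: "root_sym s = NT A" "occurs P c s u' y'"
      using occurs_label[OF _ c(2)] val c(1) by (meson valid_Nd)
    obtain v x where occ': "occurs P (Nd A ts) s v x"
      using occurs_child[OF val c(1) s(2)] by blast
    have "size s < size (Nd A ts)"
      using s(2) size_list_estimation'[OF c(1), of "size c" size] by (simp add: occurs_def)
    moreover have "valid P s" using s(2) by (simp add: occurs_def)
    ultimately obtain t' where t': "valid P t'" "root_sym t' = root_sym t"
      "yield t' = u @ yield s @ y" "size t' < size t"
      using occ s(1) unfolding occurs_def by (metis root_sym.simps(2))
    have yield: "yield (Nd A ts) = v @ yield s @ x" using occ' by (simp add: occurs_def)
    then have z_eq: "z = u @ v @ yield s @ x @ y" using occ t by (simp add: occurs_def)
    \<comment> \<open>Otherwise \<open>t'\<close> would be a smaller tree for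
      \<open>z\<close>.\<close>
    have "v @ x \<noteq> []" using least[of t'] t t' z_eq by auto
    moreover have "length (v @ yield s @ x) \<le> b * m"
    proof -
      have "length (yield (Nd A ts)) \<le> length ts * m"
        unfolding yield.simps by (rule length_concat_le) (use short free val in simp)
      also have "\<dots> \<le> b * m" using b[of A "map root_sym ts"] val by simp
      finally show ?thesis unfolding yield .
    qed
    moreover have "u @ yield s @ y \<in> L" using t t' unfolding L generated_iff_ptree by metis
    ultimately show ?thesis using z_eq by blast
  qed
  then show ?thesis by blast
qed

section \<open>Values in the base given by a shear\<close>

lemma base_value_Nil [simp]: "base_value M [] = 0"
  by (simp add: base_value_def)

lemma base_value_Cons: "base_value M (a # w) = matrix_pow M (length w) *v a + base_value M w"
proof -
  have "(\<Sum>i<length w. matrix_pow M i *v ((rev w @ [a]) ! i)) = base_value M w"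
    unfolding base_value_def by (rule sum.cong) (auto simp: nth_append)
  then show ?thesis by (simp add: base_value_def nth_append)
qed

abbreviation (input) shear :: "int ^ 2 ^ 2" where
  "shear \<equiv> vector [vector [1, 1], vector [0, 1]]"

lemma matrix_pow_shear: "matrix_pow shear k = vector [vector [1, int k], vector [0, 1]]"
  by (induction k) (auto simp: vec_eq_iff forall_2 matrix_matrix_mult_def sum_2 mat_def)

lemma matrix_pow_shear_mult: "matrix_pow shear k *v vector [0, s] = vector [int k * s, s]"
  by (simp add: matrix_pow_shear vec_eq_iff forall_2 matrix_vector_mult_def sum_2)

text \<open>The positions in the block run from \<open>length w\<close> to
  \<open>length w + n - 1\<close>; doubling avoids the division in the sum of this
  progression.\<close>

lemma base_value_replicate_append:
  "base_value shear (replicate n (vector [0, s]) @ w) $ 2 = s * int n + base_value shear w $ 2"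
  "2 * base_value shear (replicate n (vector [0, s]) @ w) $ 1 =
    s * int n * (int n - 1 + 2 * int (length w)) + 2 * base_value shear w $ 1"
  by (induction n) (auto simp: base_value_Cons matrix_pow_shear_mult algebra_simps)

lemma base_value_three_blocks_zero:
  assumes "base_value shear
    (replicate i (vector [0, 1]) @ replicate j (vector [0, -1]) @ replicate k (vector [0, 1])) = 0"
  shows "i = k \<and> j = 2 * k"
proof -
  let ?a = "vector [0, 1] :: int ^ 2" and ?b = "vector [0, -1] :: int ^ 2"
  \<comment> \<open>The final \<open>[]\<close> lets the append rule apply to the last block
    too.\<close>
  let ?w = "replicate i ?a @ replicate j ?b @ replicate k ?a @ []"
  have zero: "base_value shear ?w = 0" using assms by simp
  have "base_value shear ?w $ 2 = int i - int j + int k"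
    by (simp only: base_value_replicate_append) simp
  with zero have j: "int j = int i + int k" by simp
  have "2 * base_value shear ?w $ 1 =
    int i * (int i - 1 + 2 * (int j + int k)) - int j * (int j - 1 + 2 * int k) + int k * (int k - 1)"
    by (simp only: base_value_replicate_append) simp
  \<comment> \<open>Substituting \<open>j = i + k\<close> cancels the mixed and linear
    terms.\<close>
  also have "\<dots> = 2 * (int i ^ 2 - int k ^ 2)"
    unfolding j by (simp add: algebra_simps power2_eq_square)
  finally have "int i ^ 2 = int k ^ 2" using zero by simp
  then have "i = k" by simp
  with j show ?thesis by simp
qed

section \<open>Subsequences of block words\<close>

lemma subseq_replicate:
  assumes "subseq xs (replicate n a)"
  shows "xs = replicate (length xs) a"
proof -
  have "x = a" if "x \<in> set xs" for x
    using list_emb_set[OF assms that] by auto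
  then show ?thesis by (intro replicate_eqI) auto
qed

lemma subseq_replicate_append:
  assumes "subseq xs (replicate m a @ replicate n b)"
  obtains i j where "xs = replicate i a @ replicate j b"
proof -
  obtain ys zs where "xs = ys @ zs" "subseq ys (replicate m a)" "subseq zs (replicate n b)"
    using assms by (auto elim: subseq_appendE)
  then show thesis using that subseq_replicate by metis
qed

text \<open>Gives the block shape after a deletion without locating \<open>v\<close> and
  \<open>x\<close> relative to the block boundary.\<close>

lemma subseq_delete: "subseq (u @ w @ y) (u @ v @ w @ x @ y)"
proof -
  have "subseq (w @ y) (w @ x @ y)" by (simp add: subseq_append' subseq_drop_many)
  then have "subseq (w @ y) (v @ w @ x @ y)" by (rule subseq_drop_many)
  then show ?thesis by (simp only: subseq_append')
qed

theorem theorem4p1: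
  fixes M :: "int ^ 2 ^ 2" and v1 v2 :: "int ^ 2" and L0 :: "(int ^ 2) list set"
  assumes "M = vector [vector [1, 1], vector [0, 1]]"
    and "v1 = vector [0, 1]"
    and "v2 = vector [0, -1]"
    and "L0 = {v. v \<noteq> [] \<and> set v \<subseteq> {v1, v2} \<and> base_value M v = 0}"
  shows "\<not> context_free L0"
proof
  assume "context_free L0"
  from context_free_pump_down[OF this] obtain n where n: "\<forall>z\<in>L0. length z > n \<longrightarrow>
    (\<exists>u v w x y. z = u @ v @ w @ x @ y \<and> v @ x \<noteq> [] \<and> length (v @ w @ x) \<le> n \<and> u @ w @ y \<in> L0)"
    by (rule exE)
  \<comment> \<open>\<open>Suc\<close> makes the word nonempty and longer than \<open>n\<close> even
    for \<open>n = 0\<close>.\<close>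
  define m where "m = Suc n"
  let ?A = "\<lambda>i. replicate i v1" and ?B = "\<lambda>i. replicate i v2"
  let ?z = "?A m @ ?B (2 * m) @ ?A m"
  have blocks: "i = k \<and> j = 2 * k" if "?A i @ ?B j @ ?A k \<in> L0" for i j k
    by (rule base_value_three_blocks_zero) (use that in \<open>simp add: assms\<close>)
  have "base_value M (?A m @ ?B (2 * m) @ ?A m @ []) = 0"
  proof -
    have "2 * base_value M (?A m @ ?B (2 * m) @ ?A m @ []) $ 1 = 0"
      unfolding assms(1-3) base_value_replicate_append by (simp add: algebra_simps)
    moreover have "base_value M (?A m @ ?B (2 * m) @ ?A m @ []) $ 2 = 0"
      unfolding assms(1-3) base_value_replicate_append by simp
    ultimately show ?thesis by (simp add: vec_eq_iff forall_2)
  qed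
  then have "?z \<in> L0" by (auto simp: assms(4) m_def)
  moreover have "length ?z > n" by (simp add: m_def)
  ultimately have "\<exists>u v w x y. ?z = u @ v @ w @ x @ y \<and> v @ x \<noteq> [] \<and> length (v @ w @ x) \<le> n \<and>
    u @ w @ y \<in> L0" by (rule n[rule_format])
  then obtain u v w x y where z: "?z = u @ v @ w @ x @ y" and ne: "v @ x \<noteq> []"
    and short: "length (v @ w @ x) \<le> n" and del: "u @ w @ y \<in> L0"
    by (elim exE conjE) (rule that)
  have pos: "length v + length x > 0" using ne by auto
  have len: "length (u @ v @ w @ x @ y) = 4 * m" unfolding z[symmetric] by simp
  show False
  \<comment> \<open>Either \<open>u\<close> contains the first block, or the factor starts inside
    that block and, being shorter than \<open>2 * m\<close>, ends before the last one.\<close>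
  proof (cases "m \<le> length u")
    case True
    define p where "p = length u"
    have "u = take p (?A m @ (?B (2 * m) @ ?A m))" unfolding z by (simp add: p_def)
    moreover have "length (?A m) \<le> p" using True by (simp add: p_def)
    ultimately obtain u' where u: "u = ?A m @ u'" by (simp only: take_append take_all)
    have "?B (2 * m) @ ?A m = u' @ v @ w @ x @ y"
      using z unfolding u by (simp only: append.assoc same_append_eq)
    then have "subseq (u' @ w @ y) (?B (2 * m) @ ?A m)" by (simp only: subseq_delete)
    then obtain j k where eq: "u' @ w @ y = ?B j @ ?A k" by (rule subseq_replicate_append)
    then have "m = k \<and> j = 2 * k" using blocks[of m j k] del u by simp
    \<comment> \<open>With the intact block the total is again \<open>4 * m\<close>, although
      letters were deleted.\<close>
    then have "length (u' @ w @ y) = 3 * m" unfolding eq by simp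
    then show False using len pos u by simp
  next
    case False
    define p where "p = length (u @ v @ w @ x)"
    have "y = drop p ((?A m @ ?B (2 * m)) @ ?A m)" using z by (simp add: p_def)
    moreover have "p \<le> length (?A m @ ?B (2 * m))"
      using False short by (simp add: p_def m_def)
    ultimately obtain y' where y: "y = y' @ ?A m" by (simp only: drop_append diff_is_0_eq' drop_0)
    have "(?A m @ ?B (2 * m)) @ ?A m = (u @ v @ w @ x @ y') @ ?A m"
      using z unfolding y by (simp only: append.assoc)
    then have "?A m @ ?B (2 * m) = u @ v @ w @ x @ y'" by (simp only: append_same_eq)
    then have "subseq (u @ w @ y') (?A m @ ?B (2 * m))" by (simp only: subseq_delete)
    then obtain i j where eq: "u @ w @ y' = ?A i @ ?B j" by (rule subseq_replicate_append)
    have "u @ w @ y = (u @ w @ y') @ ?A m" unfolding y by (simp only: append.assoc)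
    then have "?A i @ ?B j @ ?A m \<in> L0" using del unfolding eq by (simp only: append.assoc)
    then have "i = m \<and> j = 2 * m" by (rule blocks)
    then have "length (u @ w @ y') = 3 * m" unfolding eq by simp
    then show False using len pos y by simp
  qed
qed

end
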